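(* Let $\mathcal{M}$ be the Fock space of the charged free bosons and let $\Omega_{U}=\sum_{i\in\mathbb{Z}}\varphi^{*}_{i}\otimes\varphi_{-i}$ acting on $\mathcal{M}\otimes\mathcal{M}$. If $\tau\in\mathcal{M}$ satisfies $$\Omega_{U}(\tau\otimes\tau)=0,$$ then $\tau=c\,|0\rangle$ for some constant $c\in\mathbb{C}$.
   Context: The charged free bosons are operators $\varphi_i,\varphi^*_i$ ($i\in\mathbb{Z}$) with commutation relations $[\varphi_i,\varphi^*_j]=\delta_{i,-j}$, $[\varphi_i,\varphi_j]=[\varphi^*_i,\varphi^*_j]=0$. The Fock space $\mathcal{M}$ is the complex module over the algebra they generate, generated by a vacuum vector $|0\rangle$ with $\varphi_i|0\rangle=\varphi^*_{i+1}|0\rangle=0$ for $i\ge 0$. It has as basis the monomials in the commuting operators $\varphi_{-i-1},\varphi^*_{-i}$ ($i\ge 0$) applied to $|0\rangle$, so that as a vector space $\mathcal{M}\simeq\mathbb{C}[\varphi_{-i-1},\varphi^*_{-i}\mid i\ge 0]\,|0\rangle$ (polynomials in infinitely many variables). On this space $\varphi_{-i-1},\varphi^*_{-i}$ ($i\geq 0$) act by multiplication, $\varphi_i$ ($i\ge0$) acts as $\partial/\partial\varphi^*_{-i}$ and $\varphi^*_i$ ($i\ge1$) acts as $-\partial/\partial\varphi_{-i}$. On any element of $\mathcal{M}\otimes\mathcal{M}$ only finitely many terms of $\Omega_U$ act nontrivially. *)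

theory Defs
  imports Complex_Main "HOL-Library.Poly_Mapping"
begin

section \<open>Complex vector spaces with a given basis\<close>

text \<open>
  \<open>'k \<Rightarrow>\<^sub>0 complex\<close> is the complex vector space with basis \<open>single k 1\<close>.
\<close>

definition scale :: "complex \<Rightarrow> ('k \<Rightarrow>\<^sub>0 complex) \<Rightarrow> ('k \<Rightarrow>\<^sub>0 complex)"
  where "scale c p = Poly_Mapping.map ((*) c) p"

definition lin_ext :: "('k \<Rightarrow> ('l \<Rightarrow>\<^sub>0 complex)) \<Rightarrow> ('k \<Rightarrow>\<^sub>0 complex) \<Rightarrow> ('l \<Rightarrow>\<^sub>0 complex)"
  where "lin_ext g p = (\<Sum>k\<in>Poly_Mapping.keys p. scale (Poly_Mapping.lookup p k) (g k))"

lemma lookup_scale [simp]: "Poly_Mapping.lookup (scale c p) k = c * Poly_Mapping.lookup p k"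
  by (simp add: scale_def Poly_Mapping.map.rep_eq when_def)

interpretation fs: vector_space "scale :: complex \<Rightarrow> ('k \<Rightarrow>\<^sub>0 complex) \<Rightarrow> _"
  by standard (auto intro!: poly_mapping_eqI simp: lookup_add algebra_simps)

lemma lin_ext_superset:
  assumes "finite S" "Poly_Mapping.keys p \<subseteq> S"
  shows "lin_ext g p = (\<Sum>k\<in>S. scale (Poly_Mapping.lookup p k) (g k))"
  unfolding lin_ext_def
  by (rule sum.mono_neutral_left) (use assms in \<open>auto simp: in_keys_iff\<close>)

lemma lin_ext_add: "lin_ext g (p + q) = lin_ext g p + lin_ext g q"
proof -
  let ?S = "Poly_Mapping.keys p \<union> Poly_Mapping.keys q"
  have "lin_ext g (p + q) = (\<Sum>k\<in>?S. scale (Poly_Mapping.lookup (p + q) k) (g k))"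
    by (rule lin_ext_superset) (use Poly_Mapping.keys_add[of p q] in auto)
  moreover have "lin_ext g p = (\<Sum>k\<in>?S. scale (Poly_Mapping.lookup p k) (g k))"
    "lin_ext g q = (\<Sum>k\<in>?S. scale (Poly_Mapping.lookup q k) (g k))"
    by (rule lin_ext_superset; auto)+
  ultimately show ?thesis
    by (simp add: lookup_add fs.scale_left_distrib sum.distrib)
qed

lemma lin_ext_scale: "lin_ext g (scale c p) = scale c (lin_ext g p)"
proof -
  have "lin_ext g (scale c p) = (\<Sum>k\<in>Poly_Mapping.keys p. scale (Poly_Mapping.lookup (scale c p) k) (g k))"
    by (rule lin_ext_superset) (auto simp: in_keys_iff)
  then show ?thesis
    by (simp add: lin_ext_def fs.scale_sum_right)
qed

lemma linear_lin_ext: "Vector_Spaces.linear scale scale (lin_ext g)"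
  by (unfold_locales) (simp_all add: lin_ext_add lin_ext_scale)

lemma scale_single [simp]: "scale c (Poly_Mapping.single k d) = Poly_Mapping.single k (c * d)"
  by (rule poly_mapping_eqI) (simp add: lookup_single when_def)

lemma lin_ext_single [simp]: "lin_ext g (Poly_Mapping.single k c) = scale c (g k)"
  by (simp add: lin_ext_def)

lemma expand_basis: "p = (\<Sum>k\<in>Poly_Mapping.keys p. scale (Poly_Mapping.lookup p k) (Poly_Mapping.single k 1))"
  by (rule poly_mapping_eqI)
    (auto simp: lookup_sum lookup_single when_def sum.delta in_keys_iff if_distrib cong: if_cong)

text \<open>Two linear maps that agree on the basis agree.\<close>

lemma linear_eq_on_basis:
  assumes f: "Vector_Spaces.linear scale sc f" and g: "Vector_Spaces.linear scale sc g"
    and eq: "\<And>k. f (Poly_Mapping.single k 1) = g (Poly_Mapping.single k 1)"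
  shows "f p = g p"
proof -
  interpret f: Vector_Spaces.linear scale sc f by (rule f)
  interpret g: Vector_Spaces.linear scale sc g by (rule g)
  have "f p = (\<Sum>k\<in>Poly_Mapping.keys p. sc (Poly_Mapping.lookup p k) (f (Poly_Mapping.single k 1)))"
    by (subst expand_basis) (simp only: f.sum f.scale)
  also have "\<dots> = g p"
    by (subst (2) expand_basis) (simp only: g.sum g.scale eq)
  finally show ?thesis .
qed

section \<open>The Fock space of the charged free bosons\<close>

text \<open>
  The creation operators: \<open>Phi i\<close> stands for \<open>\<phi>\<^bsub>-i-1\<^esub>\<close> and \<open>PhiStar i\<close> for \<open>\<phi>\<^sup>*\<^bsub>-i\<^esub>\<close>
  (\<open>i \<ge> 0\<close>).  A monomial is a finitely supported exponent function, so that \<open>fock\<close> is the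
  polynomial ring over the complex numbers in these variables.
\<close>

datatype creator = Phi nat | PhiStar nat

type_synonym monomial = "creator \<Rightarrow>\<^sub>0 nat"
type_synonym fock = "monomial \<Rightarrow>\<^sub>0 complex"

definition vacuum :: fock
  where "vacuum = 1"

definition mult_var :: "creator \<Rightarrow> fock \<Rightarrow> fock"
  where "mult_var x p = Poly_Mapping.single (Poly_Mapping.single x 1) 1 * p"

text \<open>
  The truncated subtraction of exponents is harmless: the coefficient vanishes when the variable
  does not occur.
\<close>

definition deriv_var :: "creator \<Rightarrow> fock \<Rightarrow> fock"
  where "deriv_var x =
    lin_ext (\<lambda>m. Poly_Mapping.single (m - Poly_Mapping.single x 1) (of_nat (Poly_Mapping.lookup m x)))"

definition phi :: "int \<Rightarrow> fock \<Rightarrow> fock"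
  where "phi i p = (if i < 0 then mult_var (Phi (nat (- i - 1))) p
                    else deriv_var (PhiStar (nat i)) p)"

definition phi_star :: "int \<Rightarrow> fock \<Rightarrow> fock"
  where "phi_star i p = (if i \<le> 0 then mult_var (PhiStar (nat (- i))) p
                         else - deriv_var (Phi (nat (i - 1))) p)"

section \<open>The tensor square and the operator \<open>\<Omega>\<close>\<close>

text \<open>
  The tensor square of the Fock space has the pairs of monomials as basis; see
  \<open>tensor_universal\<close> below for the universal property.
\<close>

type_synonym fock2 = "(monomial \<times> monomial) \<Rightarrow>\<^sub>0 complex"

definition tensor :: "fock \<Rightarrow> fock \<Rightarrow> fock2"
  where "tensor u v =
    (\<Sum>m\<in>Poly_Mapping.keys u. \<Sum>n\<in>Poly_Mapping.keys v. Poly_Mapping.single (m, n) (Poly_Mapping.lookup u m * Poly_Mapping.lookup v n))"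

definition tensor_op :: "(fock \<Rightarrow> fock) \<Rightarrow> (fock \<Rightarrow> fock) \<Rightarrow> fock2 \<Rightarrow> fock2"
  where "tensor_op A B =
    lin_ext (\<lambda>(m, n). tensor (A (Poly_Mapping.single m 1)) (B (Poly_Mapping.single n 1)))"

text \<open>
  \<open>Sum_any\<close> adds the nonzero terms of a family; by \<open>finite_Omega\<close> below there are
  only finitely many of them.
\<close>

definition Omega :: "fock2 \<Rightarrow> fock2"
  where "Omega t = Sum_any (\<lambda>i::int. tensor_op (phi_star i) (phi (- i)) t)"

section \<open>The defining properties\<close>

lemma linear_deriv_var: "Vector_Spaces.linear scale scale (deriv_var x)"
  unfolding deriv_var_def by (rule linear_lin_ext)

lemma scale_conv_mult: "scale c p = Poly_Mapping.single 0 c * (p :: fock)"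
  unfolding scale_def by (rule mult_map_scale_conv_mult)

lemma linear_mult_var: "Vector_Spaces.linear scale scale (mult_var x)"
  by unfold_locales (simp_all add: mult_var_def scale_conv_mult algebra_simps)

lemma linear_phi: "Vector_Spaces.linear scale scale (phi i)"
  using linear_deriv_var linear_mult_var by (cases "i < 0") (auto simp: phi_def[abs_def])

lemma linear_phi_star: "Vector_Spaces.linear scale scale (phi_star i)"
proof (cases "i \<le> 0")
  case False
  interpret d: Vector_Spaces.linear scale scale "deriv_var (Phi (nat (i - 1)))"
    by (rule linear_deriv_var)
  from False show ?thesis
    by unfold_locales (auto simp: phi_star_def d.add d.scale)
qed (use linear_mult_var in \<open>auto simp: phi_star_def[abs_def]\<close>)

lemma lookup_deriv_var:
  "Poly_Mapping.lookup (deriv_var x p) m = of_nat (Poly_Mapping.lookup m x + 1) * Poly_Mapping.lookup p (m + Poly_Mapping.single x 1)"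
proof -
  have key: "k - Poly_Mapping.single x 1 = m \<and> Poly_Mapping.lookup k x \<noteq> 0 \<longleftrightarrow> k = m + Poly_Mapping.single x 1"
    for k
    by (auto simp: poly_mapping_eq_iff fun_eq_iff lookup_add lookup_minus lookup_single when_def)
  have "Poly_Mapping.lookup (deriv_var x p) m =
     (\<Sum>k\<in>Poly_Mapping.keys p. Poly_Mapping.lookup p k * (of_nat (Poly_Mapping.lookup k x) when k - Poly_Mapping.single x 1 = m))"
    by (simp add: deriv_var_def lin_ext_def lookup_sum lookup_single mult_when)
  also have "\<dots> = (\<Sum>k\<in>Poly_Mapping.keys p. if k = m + Poly_Mapping.single x 1
       then of_nat (Poly_Mapping.lookup m x + 1) * Poly_Mapping.lookup p k else 0)"
  proof (rule sum.cong[OF refl])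
    fix k
    show "Poly_Mapping.lookup p k * (of_nat (Poly_Mapping.lookup k x) when k - Poly_Mapping.single x 1 = m) =
      (if k = m + Poly_Mapping.single x 1 then of_nat (Poly_Mapping.lookup m x + 1) * Poly_Mapping.lookup p k else 0)"
      using key[of k] by (auto simp: when_def lookup_add)
  qed
  also have "\<dots> = of_nat (Poly_Mapping.lookup m x + 1) * Poly_Mapping.lookup p (m + Poly_Mapping.single x 1)"
    by (simp add: sum.delta in_keys_iff)
  finally show ?thesis .
qed

lemma deriv_var_leibniz:
  "deriv_var x (mult_var y p) = mult_var y (deriv_var x p) + (if x = y then p else 0)"
proof -
  interpret d: Vector_Spaces.linear scale scale "deriv_var x" by (rule linear_deriv_var)
  interpret u: Vector_Spaces.linear scale scale "mult_var y" by (rule linear_mult_var)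
  have *: "deriv_var x (mult_var y (Poly_Mapping.single m c)) =
      mult_var y (deriv_var x (Poly_Mapping.single m c)) + (if x = y then Poly_Mapping.single m c else 0)"
    for m c
  proof -
    have 1: "Poly_Mapping.single y 1 + m - Poly_Mapping.single x 1
        = Poly_Mapping.single y 1 + (m - Poly_Mapping.single x 1)"
      if "x \<noteq> y \<or> Poly_Mapping.lookup m x \<noteq> 0"
      using that by (auto simp: poly_mapping_eq_iff fun_eq_iff lookup_add lookup_minus
          lookup_single when_def)
    have 2: "Poly_Mapping.single x 1 + (m - Poly_Mapping.single x 1) = m"
      if "Poly_Mapping.lookup m x \<noteq> 0"
      using that by (auto simp: poly_mapping_eq_iff fun_eq_iff lookup_add lookup_minus
          lookup_single when_def)
    show ?thesis
    proof (cases "x = y")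
      case False
      then show ?thesis
        by (simp add: deriv_var_def mult_var_def mult_single lookup_add lookup_single 1
            del: One_nat_def)
    next
      case True
      show ?thesis
      proof (cases "Poly_Mapping.lookup m x = 0")
        case True
        with \<open>x = y\<close> show ?thesis
          by (simp add: deriv_var_def mult_var_def mult_single lookup_add lookup_single)
      next
        case False
        note 12 = 1[OF disjI2[OF False]] 2[OF False]
        show ?thesis
          by (simp add: True[symmetric] deriv_var_def mult_var_def mult_single lookup_add
              lookup_single 12 single_add[symmetric] algebra_simps del: One_nat_def)
      qed
    qed
  qed
  have l: "Vector_Spaces.linear scale scale (\<lambda>p. deriv_var x (mult_var y p))"
    by unfold_locales (simp_all add: d.add u.add d.scale u.scale)
  have r: "Vector_Spaces.linear scale scale
      (\<lambda>p. mult_var y (deriv_var x p) + (if x = y then p else 0))"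
    by unfold_locales (simp_all add: d.add u.add d.scale u.scale fs.scale_right_distrib)
  show ?thesis
    by (rule linear_eq_on_basis[OF l r]) (rule *)
qed

lemma mult_var_commute: "mult_var x (mult_var y p) = mult_var y (mult_var x p)"
  by (simp add: mult_var_def algebra_simps)

lemma deriv_var_commute: "deriv_var x (deriv_var y p) = deriv_var y (deriv_var x p)"
  by (rule poly_mapping_eqI)
    (auto simp: lookup_deriv_var lookup_add lookup_single when_def algebra_simps)

lemma phi_phi_star_commutator:
  "phi i (phi_star j p) - phi_star j (phi i p) = (if i = - j then p else 0)"
proof -
  interpret d: Vector_Spaces.linear scale scale "deriv_var x" for x by (rule linear_deriv_var)
  interpret u: Vector_Spaces.linear scale scale "mult_var x" for x by (rule linear_mult_var)
  show ?thesis
    by (auto simp: phi_def phi_star_def deriv_var_leibniz mult_var_commute deriv_var_commute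
        d.neg u.neg nat_eq_iff)
qed

lemma phi_commute: "phi i (phi j p) = phi j (phi i p)"
  by (auto simp: phi_def deriv_var_leibniz mult_var_commute deriv_var_commute)

lemma phi_star_commute: "phi_star i (phi_star j p) = phi_star j (phi_star i p)"
proof -
  interpret d: Vector_Spaces.linear scale scale "deriv_var x" for x by (rule linear_deriv_var)
  interpret u: Vector_Spaces.linear scale scale "mult_var x" for x by (rule linear_mult_var)
  show ?thesis
    by (auto simp: phi_star_def deriv_var_leibniz mult_var_commute deriv_var_commute d.neg u.neg)
qed

lemma deriv_var_vacuum: "deriv_var x vacuum = 0"
proof (rule poly_mapping_eqI)
  fix m :: monomial
  have "Poly_Mapping.lookup (m + Poly_Mapping.single x 1) x \<noteq> 0"
    by (simp add: lookup_add)
  then have "m + Poly_Mapping.single x 1 \<noteq> 0"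
    by (metis lookup_zero)
  then show "Poly_Mapping.lookup (deriv_var x vacuum) m = Poly_Mapping.lookup 0 m"
    by (simp add: lookup_deriv_var vacuum_def lookup_one del: One_nat_def)
qed

lemma phi_vacuum: "i \<ge> 0 \<Longrightarrow> phi i vacuum = 0"
  by (simp add: phi_def deriv_var_vacuum)

lemma phi_star_vacuum: "i \<ge> 0 \<Longrightarrow> phi_star (i + 1) vacuum = 0"
  by (simp add: phi_star_def deriv_var_vacuum)

lemma vacuum_cyclic:
  assumes vac: "vacuum \<in> S" and add: "\<And>p q. p \<in> S \<Longrightarrow> q \<in> S \<Longrightarrow> p + q \<in> S"
    and sc: "\<And>c p. p \<in> S \<Longrightarrow> scale c p \<in> S"
    and phi: "\<And>i p. p \<in> S \<Longrightarrow> phi i p \<in> S" and phi_star: "\<And>i p. p \<in> S \<Longrightarrow> phi_star i p \<in> S"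
  shows "p \<in> S"
proof -
  have mult: "mult_var x q \<in> S" if "q \<in> S" for x q
  proof (cases x)
    case (Phi j)
    then show ?thesis using phi[OF that, of "- int j - 1"] by (simp add: phi_def)
  next
    case (PhiStar j)
    then show ?thesis using phi_star[OF that, of "- int j"] by (simp add: phi_star_def)
  qed
  have pow: "Poly_Mapping.single (Poly_Mapping.single x n) 1 * q \<in> S" if "q \<in> S" for x n q
  proof (induction n)
    case (Suc n)
    have "Poly_Mapping.single (Poly_Mapping.single x (Suc n)) 1 * q =
        mult_var x (Poly_Mapping.single (Poly_Mapping.single x n) 1 * q)"
      by (simp add: mult_var_def mult.assoc[symmetric] mult_single single_add[symmetric])
    with mult[OF Suc] show ?case by simp
  qed (use that in simp)
  have mono: "Poly_Mapping.single m 1 \<in> S" for m :: monomial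
  proof (induction m rule: update_induct)
    case const
    then show ?case using vac by (simp add: vacuum_def)
  next
    case (update f a b)
    have "Poly_Mapping.update a b f = Poly_Mapping.single a b + f"
      using update(1) by (intro poly_mapping_eqI)
        (auto simp: lookup_update lookup_add lookup_single when_def in_keys_iff)
    with pow[OF update(3), of a b] show ?case
      by (simp add: mult_single)
  qed
  have "(\<Sum>k\<in>A. scale (Poly_Mapping.lookup p k) (Poly_Mapping.single k 1)) \<in> S" for A
  proof (induction A rule: infinite_finite_induct)
    case (insert x F)
    then show ?case
      using add[OF sc[OF mono] insert.IH] by simp
  qed (use sc[OF vac, of 0] in simp_all)
  then show ?thesis
    by (subst expand_basis)
qed

lemma lookup_tensor [simp]: "Poly_Mapping.lookup (tensor u v) (m, n) = Poly_Mapping.lookup u m * Poly_Mapping.lookup v n"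
proof -
  have "Poly_Mapping.lookup (tensor u v) (m, n) = (\<Sum>a\<in>Poly_Mapping.keys u. if a = m then
      (\<Sum>b\<in>Poly_Mapping.keys v. if b = n then Poly_Mapping.lookup u a * Poly_Mapping.lookup v b else 0) else 0)"
    unfolding tensor_def lookup_sum lookup_single
    by (intro sum.cong refl) (auto simp: when_def)
  then show ?thesis
    by (auto simp: sum.delta in_keys_iff)
qed

lemma tensor_add_left: "tensor (u + u') v = tensor u v + tensor u' v"
  by (rule poly_mapping_eqI) (auto simp: lookup_add algebra_simps)

lemma tensor_add_right: "tensor u (v + v') = tensor u v + tensor u v'"
  by (rule poly_mapping_eqI) (auto simp: lookup_add algebra_simps)

lemma tensor_scale_left: "tensor (scale c u) v = scale c (tensor u v)"
  by (rule poly_mapping_eqI) auto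

lemma tensor_scale_right: "tensor u (scale c v) = scale c (tensor u v)"
  by (rule poly_mapping_eqI) auto

lemma tensor_zero [simp]: "tensor 0 v = 0" "tensor u 0 = 0"
  by (simp_all add: tensor_def)

lemma tensor_single:
  "tensor (Poly_Mapping.single m c) (Poly_Mapping.single n d) = Poly_Mapping.single (m, n) (c * d)"
proof (rule poly_mapping_eqI)
  fix k
  show "Poly_Mapping.lookup (tensor (Poly_Mapping.single m c) (Poly_Mapping.single n d)) k =
      Poly_Mapping.lookup (Poly_Mapping.single (m, n) (c * d)) k"
    by (cases k) (auto simp: lookup_single when_def)
qed

lemma linear_tensor_left: "Vector_Spaces.linear scale scale (\<lambda>u. tensor u v)"
  by unfold_locales (simp_all add: tensor_add_left tensor_scale_left)

lemma linear_tensor_right: "Vector_Spaces.linear scale scale (tensor u)"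
  by unfold_locales (simp_all add: tensor_add_right tensor_scale_right)

theorem tensor_universal:
  assumes left: "\<And>v. Vector_Spaces.linear scale sc (\<lambda>u. B u v)"
    and right: "\<And>u. Vector_Spaces.linear scale sc (B u)"
  shows "\<exists>!L. Vector_Spaces.linear scale sc L \<and> (\<forall>u v. L (tensor u v) = B u v)"
proof (rule ex_ex1I)
  interpret l: Vector_Spaces.linear scale sc "\<lambda>u. B u v" for v by (rule left)
  define g where "g = (\<lambda>(m, n). B (Poly_Mapping.single m 1) (Poly_Mapping.single n 1))"
  define L where "L p = (\<Sum>k\<in>Poly_Mapping.keys p. sc (Poly_Mapping.lookup p k) (g k))" for p
  have sup: "L p = (\<Sum>k\<in>S. sc (Poly_Mapping.lookup p k) (g k))" if "finite S" "Poly_Mapping.keys p \<subseteq> S" for p S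
    unfolding L_def
    by (rule sum.mono_neutral_left) (use that in \<open>auto simp: in_keys_iff\<close>)
  have L: "Vector_Spaces.linear scale sc L"
  proof unfold_locales
    fix p q :: fock2
    let ?S = "Poly_Mapping.keys p \<union> Poly_Mapping.keys q"
    have "L (p + q) = (\<Sum>k\<in>?S. sc (Poly_Mapping.lookup (p + q) k) (g k))"
      by (rule sup) (use Poly_Mapping.keys_add[of p q] in auto)
    moreover have "L p = (\<Sum>k\<in>?S. sc (Poly_Mapping.lookup p k) (g k))"
      "L q = (\<Sum>k\<in>?S. sc (Poly_Mapping.lookup q k) (g k))"
      by (rule sup; auto)+
    ultimately show "L (p + q) = L p + L q"
      by (simp add: lookup_add l.vs2.scale_left_distrib sum.distrib)
  next
    fix c and p :: fock2
    have "L (scale c p) = (\<Sum>k\<in>Poly_Mapping.keys p. sc (Poly_Mapping.lookup (scale c p) k) (g k))"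
      by (rule sup) (auto simp: in_keys_iff)
    then show "L (scale c p) = sc c (L p)"
      by (simp add: L_def l.vs2.scale_sum_right)
  qed
  have comp: "Vector_Spaces.linear scale sc (\<lambda>u. L (f u))"
    if "Vector_Spaces.linear scale scale f" for f :: "fock \<Rightarrow> fock2"
    using Vector_Spaces.linear_compose[OF that L] by (simp add: o_def)
  have "L (tensor u v) = B u v" for u v
  proof (rule linear_eq_on_basis[where f = "\<lambda>u. L (tensor u v)" and g = "\<lambda>u. B u v",
        OF comp[OF linear_tensor_left] left])
    fix m
    show "L (tensor (Poly_Mapping.single m 1) v) = B (Poly_Mapping.single m 1) v"
      by (rule linear_eq_on_basis[where f = "\<lambda>v. L (tensor _ v)", OF comp[OF linear_tensor_right] right])
        (simp add: tensor_single L_def g_def)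
  qed
  with L show "\<exists>L. Vector_Spaces.linear scale sc L \<and> (\<forall>u v. L (tensor u v) = B u v)"
    by blast
next
  fix L L'
  assume L: "Vector_Spaces.linear scale sc L \<and> (\<forall>u v. L (tensor u v) = B u v)"
    and L': "Vector_Spaces.linear scale sc L' \<and> (\<forall>u v. L' (tensor u v) = B u v)"
  show "L = L'"
  proof
    fix p
    have s: "Poly_Mapping.single k 1 =
        tensor (Poly_Mapping.single (fst k) 1) (Poly_Mapping.single (snd k) 1)" for k
      by (simp add: tensor_single)
    show "L p = L' p"
      by (rule linear_eq_on_basis[of sc]) (use L L' in \<open>auto simp: s\<close>)
  qed
qed

lemma tensor_op_tensor:
  assumes A: "Vector_Spaces.linear scale scale A" and B: "Vector_Spaces.linear scale scale B"
  shows "tensor_op A B (tensor u v) = tensor (A u) (B v)"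
proof -
  have comp: "Vector_Spaces.linear scale scale (\<lambda>x. f (g x))"
    if "Vector_Spaces.linear scale scale g" "Vector_Spaces.linear scale scale f"
    for f :: "('b \<Rightarrow>\<^sub>0 complex) \<Rightarrow> ('c \<Rightarrow>\<^sub>0 complex)" and g :: "('a \<Rightarrow>\<^sub>0 complex) \<Rightarrow> ('b \<Rightarrow>\<^sub>0 complex)"
    using Vector_Spaces.linear_compose[OF that] by (simp add: o_def)
  have T: "Vector_Spaces.linear scale scale (tensor_op A B)"
    unfolding tensor_op_def by (rule linear_lin_ext)
  show ?thesis
  proof (rule linear_eq_on_basis[where f = "\<lambda>u. tensor_op A B (tensor u v)"
        and g = "\<lambda>u. tensor (A u) (B v)", OF comp[OF linear_tensor_left T] comp[OF A linear_tensor_left]])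
    fix m
    show "tensor_op A B (tensor (Poly_Mapping.single m 1) v) = tensor (A (Poly_Mapping.single m 1)) (B v)"
      by (rule linear_eq_on_basis[where f = "\<lambda>v. tensor_op A B (tensor _ v)"
          and g = "\<lambda>v. tensor (A _) (B v)", OF comp[OF linear_tensor_right T] comp[OF B linear_tensor_right]])
        (simp add: tensor_single tensor_op_def)
  qed
qed

lemma finite_Omega: "finite {i::int. tensor_op (phi_star i) (phi (- i)) t \<noteq> 0}"
proof -
  have fin: "finite {i. tensor (phi_star i (Poly_Mapping.single m 1)) (phi (- i) (Poly_Mapping.single n 1)) \<noteq> 0}"
    (is "finite ?I") for m n
  proof -
    have "?I \<subseteq> (\<lambda>x. case x of Phi j \<Rightarrow> int j + 1 | PhiStar j \<Rightarrow> - int j) ` (Poly_Mapping.keys m \<union> Poly_Mapping.keys n)"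
    proof
      fix i
      assume i: "i \<in> ?I"
      show "i \<in> (\<lambda>x. case x of Phi j \<Rightarrow> int j + 1 | PhiStar j \<Rightarrow> - int j) ` (Poly_Mapping.keys m \<union> Poly_Mapping.keys n)"
      proof (cases "i \<le> 0")
        case True
        with i have "Poly_Mapping.lookup n (PhiStar (nat (- i))) \<noteq> 0"
          by (intro notI) (simp add: phi_def deriv_var_def)
        with True show ?thesis
          by (intro image_eqI[of _ _ "PhiStar (nat (- i))"]) (auto simp: in_keys_iff)
      next
        case False
        with i have "Poly_Mapping.lookup m (Phi (nat (i - 1))) \<noteq> 0"
          by (intro notI) (simp add: phi_star_def deriv_var_def)
        with False show ?thesis
          by (intro image_eqI[of _ _ "Phi (nat (i - 1))"]) (auto simp: in_keys_iff)
      qed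
    qed
    then show ?thesis
      by (rule finite_subset) simp
  qed
  have "{i. tensor_op (phi_star i) (phi (- i)) t \<noteq> 0} \<subseteq>
    (\<Union>(m, n)\<in>Poly_Mapping.keys t. {i. tensor (phi_star i (Poly_Mapping.single m 1)) (phi (- i) (Poly_Mapping.single n 1)) \<noteq> 0})"
    by (force simp: tensor_op_def lin_ext_def intro: sum.neutral)
  then show ?thesis
    by (rule finite_subset) (auto intro: fin)
qed

end

theory Submission
  imports Defs
begin

text \<open>
  Write \<open>x\<^sub>j\<close> for \<open>Phi j\<close> and \<open>y\<^sub>j\<close> for \<open>PhiStar j\<close>.  The hypothesis reads
  \<open>(\<Sum>j. y\<^sub>j \<tau> \<otimes> \<partial>\<tau>/\<partial>y\<^sub>j) = (\<Sum>j. \<partial>\<tau>/\<partial>x\<^sub>j \<otimes> x\<^sub>j \<tau>)\<close>.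
  Give \<open>x\<^sub>j\<close> and \<open>y\<^sub>j\<close> the weight \<open>j + 1\<close>, let \<open>a\<close> be a monomial of maximal weight in \<open>\<tau>\<close>, and suppose
  that some \<open>y\<^sub>j\<close> occurs in \<open>\<tau>\<close>; let \<open>J\<close> be the largest such \<open>j\<close> and \<open>n y\<^sub>J\<close> a monomial of \<open>\<tau>\<close>.
  In the coefficient of \<open>a y\<^sub>J \<otimes> n\<close> only the term \<open>y\<^sub>J \<tau> \<otimes> \<partial>\<tau>/\<partial>y\<^sub>J\<close> contributes: the monomials \<open>a y\<^sub>J x\<^sub>j\<close>
  and, for \<open>j < J\<close>, \<open>a y\<^sub>J / y\<^sub>j\<close> are heavier than \<open>a\<close>, while \<open>y\<^sub>j\<close> does not occur in \<open>\<tau>\<close> for \<open>j > J\<close>.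
  That term is nonzero, a contradiction.  The variables \<open>x\<^sub>j\<close> are excluded in the same way, with the two
  tensor factors exchanged.
\<close>

lemma mult_var_conv_lin_ext:
  "mult_var x p = lin_ext (\<lambda>m. Poly_Mapping.single (m + Poly_Mapping.single x 1) 1) p"
  by (rule linear_eq_on_basis[OF linear_mult_var linear_lin_ext])
    (simp add: mult_var_def mult_single add.commute)

lemma add_single_in_keys_mult_var_iff:
  "m + Poly_Mapping.single x 1 \<in> Poly_Mapping.keys (mult_var x p) \<longleftrightarrow> m \<in> Poly_Mapping.keys p"
  by (simp add: mult_var_conv_lin_ext lin_ext_def lookup_sum lookup_single when_def sum.delta
      in_keys_iff if_distrib cong: if_cong)

lemma keys_mult_var:
  assumes "m \<in> Poly_Mapping.keys (mult_var x p)"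
  obtains b where "b \<in> Poly_Mapping.keys p" "m = b + Poly_Mapping.single x 1"
proof -
  have "(\<Sum>k\<in>Poly_Mapping.keys p. Poly_Mapping.lookup p k *
      (1 when k + Poly_Mapping.single x 1 = m)) \<noteq> 0"
    using assms by (simp add: mult_var_conv_lin_ext lin_ext_def lookup_sum lookup_single in_keys_iff mult_when)
  then obtain b where "b \<in> Poly_Mapping.keys p" "b + Poly_Mapping.single x 1 = m"
    by (auto elim!: sum.not_neutral_contains_not_neutral simp: when_def split: if_splits)
  then show thesis using that by blast
qed

text \<open>Differentiation multiplies the coefficient by the exponent
  \<open>lookup m x + 1\<close>, which is nonzero in characteristic zero.\<close>

lemma keys_deriv_var_iff:
  "m \<in> Poly_Mapping.keys (deriv_var x p) \<longleftrightarrow> m + Poly_Mapping.single x 1 \<in> Poly_Mapping.keys p"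
  by (simp add: in_keys_iff lookup_deriv_var del: of_nat_add of_nat_Suc)

text \<open>The coefficient at \<open>(m, n)\<close> is a sum of products over \<open>i\<close>. If
  at most the \<open>j\<close>-th product survives, it must be zero, and one of its complex factors
  vanishes.\<close>

lemma Omega_coefficient_vanishes:
  assumes "Omega (tensor u v) = 0"
    and others: "\<And>i. i \<noteq> j \<Longrightarrow> m \<in> Poly_Mapping.keys (phi_star i u) \<Longrightarrow>
      n \<notin> Poly_Mapping.keys (phi (- i) v)"
  shows "m \<notin> Poly_Mapping.keys (phi_star j u) \<or> n \<notin> Poly_Mapping.keys (phi (- j) v)"
proof -
  let ?f = "\<lambda>i. tensor_op (phi_star i) (phi (- i)) (tensor u v)"
  \<comment> \<open>Adjoining \<open>j\<close> keeps its term in the finite sum even if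
    \<open>?f j\<close> is zero.\<close>
  let ?S = "insert j {i. ?f i \<noteq> 0}"
  have fin: "finite ?S" using finite_Omega by simp
  have Omega: "Omega (tensor u v) = sum ?f ?S"
    unfolding Omega_def by (rule Sum_any.expand_superset[OF fin]) auto
  have "0 = (\<Sum>i\<in>?S. Poly_Mapping.lookup (?f i) (m, n))"
    by (simp only: lookup_sum[symmetric] Omega[symmetric] assms(1) lookup_zero)
  also have "\<dots> = (\<Sum>i\<in>?S. if i = j
      then Poly_Mapping.lookup (phi_star j u) m * Poly_Mapping.lookup (phi (- j) v) n else 0)"
  proof (rule sum.cong[OF refl])
    fix i
    have "Poly_Mapping.lookup (?f i) (m, n) =
        Poly_Mapping.lookup (phi_star i u) m * Poly_Mapping.lookup (phi (- i) v) n"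
      by (simp only: tensor_op_tensor[OF linear_phi_star linear_phi] lookup_tensor)
    with others[of i] show "Poly_Mapping.lookup (?f i) (m, n) = (if i = j
        then Poly_Mapping.lookup (phi_star j u) m * Poly_Mapping.lookup (phi (- j) v) n else 0)"
      unfolding in_keys_iff by (metis mult_eq_0_iff)
  qed
  also have "\<dots> = Poly_Mapping.lookup (phi_star j u) m * Poly_Mapping.lookup (phi (- j) v) n"
    using fin by (subst sum.delta) auto
  finally show ?thesis by (simp add: in_keys_iff)
qed

fun creator_weight :: "creator \<Rightarrow> nat"
  where "creator_weight (Phi j) = Suc j"
  | "creator_weight (PhiStar j) = Suc j"

definition weight :: "monomial \<Rightarrow> nat"
  where "weight m = (\<Sum>x\<in>Poly_Mapping.keys m. Poly_Mapping.lookup m x * creator_weight x)"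

lemma weight_add_single: "weight (m + Poly_Mapping.single x 1) = weight m + creator_weight x"
proof -
  let ?S = "insert x (Poly_Mapping.keys m)"
  have sup: "weight k = (\<Sum>y\<in>?S. Poly_Mapping.lookup k y * creator_weight y)"
    if "Poly_Mapping.keys k \<subseteq> ?S" for k
    unfolding weight_def by (rule sum.mono_neutral_left) (use that in \<open>auto simp: in_keys_iff\<close>)
  have "Poly_Mapping.keys (m + Poly_Mapping.single x 1) \<subseteq> ?S"
    using Poly_Mapping.keys_add[of m "Poly_Mapping.single x 1"] by auto
  then have "weight (m + Poly_Mapping.single x 1) =
      (\<Sum>y\<in>?S. Poly_Mapping.lookup m y * creator_weight y + (if y = x then creator_weight y else 0))"
    by (subst sup, assumption, intro sum.cong refl) (auto simp: lookup_add lookup_single algebra_simps)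
  also have "\<dots> = weight m + creator_weight x"
    by (subst sup[of m]) (auto simp: sum.distrib sum.delta)
  finally show ?thesis .
qed

text \<open>Treats both families at once, with \<open>C\<close> being \<open>PhiStar\<close> or
  \<open>Phi\<close>. The third conclusion removes the terms that differentiate the factor of
  \<open>a\<close>, the fourth those that multiply it by some \<open>C j\<close> with
  \<open>j\<close> other than \<open>J\<close>.\<close>

lemma creator_family_extremal:
  fixes C :: "nat \<Rightarrow> creator" and p :: fock
  assumes C: "\<And>j. creator_weight (C j) = Suc j"
    and occurs: "k \<in> Poly_Mapping.keys p" "C i \<in> Poly_Mapping.keys k"
  obtains a n J where "a \<in> Poly_Mapping.keys p"
    and "n + Poly_Mapping.single (C J) 1 \<in> Poly_Mapping.keys p"
    and "\<And>x. a + Poly_Mapping.single (C J) 1 + Poly_Mapping.single x 1 \<notin> Poly_Mapping.keys p"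
    and "\<And>b j. b \<in> Poly_Mapping.keys p \<Longrightarrow>
      a + Poly_Mapping.single (C J) 1 = b + Poly_Mapping.single (C j) 1 \<Longrightarrow>
      n + Poly_Mapping.single (C j) 1 \<in> Poly_Mapping.keys p \<Longrightarrow> j = J"
proof -
  let ?K = "Poly_Mapping.keys p"
  obtain a where a: "a \<in> ?K" and "weight a = Max (weight ` ?K)"
    using occurs(1) Max_in[of "weight ` ?K"] by fastforce
  then have a_max: "weight b \<le> weight a" if "b \<in> ?K" for b
    using that by simp
  define D where "D = {j. \<exists>k\<in>?K. C j \<in> Poly_Mapping.keys k}"
  have "inj C"
    by (rule injI) (metis C nat.inject)
  then have "finite (C -` (\<Union>k\<in>?K. Poly_Mapping.keys k))"
    by (intro finite_vimageI) auto
  then have fin: "finite D"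
    by (rule rev_finite_subset) (auto simp: D_def)
  have "D \<noteq> {}" using occurs by (auto simp: D_def)
  define J where "J = Max D"
  have "J \<in> D" unfolding J_def by (rule Max_in) fact+
  then obtain l where l: "l \<in> ?K" "C J \<in> Poly_Mapping.keys l"
    by (auto simp: D_def)
  \<comment> \<open>Truncated subtraction is exact here because \<open>C J\<close> occurs in
    \<open>l\<close>.\<close>
  have "l - Poly_Mapping.single (C J) 1 + Poly_Mapping.single (C J) 1 = l"
    using l(2) by (intro poly_mapping_eqI)
      (auto simp: lookup_add lookup_minus lookup_single when_def in_keys_iff)
  with l(1) have n: "l - Poly_Mapping.single (C J) 1 + Poly_Mapping.single (C J) 1 \<in> ?K"
    by simp
  show thesis
  proof (rule that[OF a n])
    show "a + Poly_Mapping.single (C J) 1 + Poly_Mapping.single x 1 \<notin> ?K" for x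
      using a_max[of "a + Poly_Mapping.single (C J) 1 + Poly_Mapping.single x 1"]
      by (auto simp: weight_add_single C simp del: One_nat_def)
  next
    fix b j
    assume b: "b \<in> ?K" "a + Poly_Mapping.single (C J) 1 = b + Poly_Mapping.single (C j) 1"
      and j: "l - Poly_Mapping.single (C J) 1 + Poly_Mapping.single (C j) 1 \<in> ?K"
    \<comment> \<open>Maximality of \<open>a\<close> bounds \<open>j\<close> from below, maximality
      of \<open>J\<close> in \<open>D\<close> from above.\<close>
    have "weight a + Suc J = weight b + Suc j"
      using arg_cong[OF b(2), of weight] by (simp add: weight_add_single C del: One_nat_def)
    with a_max[OF b(1)] have "J \<le> j" by simp
    moreover have "j \<in> D"
      unfolding D_def using j by (force simp: in_keys_iff lookup_add)
    then have "j \<le> J" unfolding J_def using fin by simp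
    ultimately show "j = J" by simp
  qed
qed

lemma PhiStar_notin_keys:
  assumes "Omega (tensor \<tau> \<tau>) = 0" "k \<in> Poly_Mapping.keys \<tau>"
  shows "PhiStar i \<notin> Poly_Mapping.keys k"
proof
  assume occurs: "PhiStar i \<in> Poly_Mapping.keys k"
  show False
  proof (rule creator_family_extremal[of PhiStar, OF creator_weight.simps(2) assms(2) occurs])
    fix a n J
    assume a: "a \<in> Poly_Mapping.keys \<tau>"
      and n: "n + Poly_Mapping.single (PhiStar J) 1 \<in> Poly_Mapping.keys \<tau>"
      and heavy: "\<And>x. a + Poly_Mapping.single (PhiStar J) 1 + Poly_Mapping.single x 1 \<notin> Poly_Mapping.keys \<tau>"
      and uniq: "\<And>b j. b \<in> Poly_Mapping.keys \<tau> \<Longrightarrow>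
        a + Poly_Mapping.single (PhiStar J) 1 = b + Poly_Mapping.single (PhiStar j) 1 \<Longrightarrow>
        n + Poly_Mapping.single (PhiStar j) 1 \<in> Poly_Mapping.keys \<tau> \<Longrightarrow> j = J"
    let ?m = "a + Poly_Mapping.single (PhiStar J) 1"
    \<comment> \<open>At this index the first factor is multiplied by \<open>PhiStar J\<close> and
      the second differentiated by it.\<close>
    have "?m \<notin> Poly_Mapping.keys (phi_star (- int J) \<tau>) \<or> n \<notin> Poly_Mapping.keys (phi (- (- int J)) \<tau>)"
    proof (rule Omega_coefficient_vanishes[OF assms(1)])
      fix j
      assume j: "j \<noteq> - int J" and m: "?m \<in> Poly_Mapping.keys (phi_star j \<tau>)"
      show "n \<notin> Poly_Mapping.keys (phi (- j) \<tau>)"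
      proof (cases "j \<le> 0")
        case True
        with m obtain b where "b \<in> Poly_Mapping.keys \<tau>"
          "?m = b + Poly_Mapping.single (PhiStar (nat (- j))) 1"
          by (auto simp: phi_star_def elim: keys_mult_var)
        with uniq[of b "nat (- j)"] True j show ?thesis
          by (auto simp: phi_def keys_deriv_var_iff simp del: One_nat_def)
      next
        case False
        with m heavy show ?thesis
          by (simp add: phi_star_def keys_deriv_var_iff del: One_nat_def)
      qed
    qed
    with a n show False
      by (simp add: phi_def phi_star_def keys_deriv_var_iff add_single_in_keys_mult_var_iff
          del: One_nat_def)
  qed
qed

lemma Phi_notin_keys:
  assumes "Omega (tensor \<tau> \<tau>) = 0" "k \<in> Poly_Mapping.keys \<tau>"
  shows "Phi i \<notin> Poly_Mapping.keys k"
proof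
  assume occurs: "Phi i \<in> Poly_Mapping.keys k"
  show False
  proof (rule creator_family_extremal[of Phi, OF creator_weight.simps(1) assms(2) occurs])
    fix a n J
    assume a: "a \<in> Poly_Mapping.keys \<tau>"
      and n: "n + Poly_Mapping.single (Phi J) 1 \<in> Poly_Mapping.keys \<tau>"
      and heavy: "\<And>x. a + Poly_Mapping.single (Phi J) 1 + Poly_Mapping.single x 1 \<notin> Poly_Mapping.keys \<tau>"
      and uniq: "\<And>b j. b \<in> Poly_Mapping.keys \<tau> \<Longrightarrow>
        a + Poly_Mapping.single (Phi J) 1 = b + Poly_Mapping.single (Phi j) 1 \<Longrightarrow>
        n + Poly_Mapping.single (Phi j) 1 \<in> Poly_Mapping.keys \<tau> \<Longrightarrow> j = J"
    let ?m = "a + Poly_Mapping.single (Phi J) 1"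
    \<comment> \<open>The shift by one is that of \<open>Phi J\<close>, which stands for the
      operator of index \<open>- J - 1\<close>. Now the first factor is differentiated, so
      \<open>n\<close> moves to the left.\<close>
    have "n \<notin> Poly_Mapping.keys (phi_star (int J + 1) \<tau>) \<or> ?m \<notin> Poly_Mapping.keys (phi (- (int J + 1)) \<tau>)"
    proof (rule Omega_coefficient_vanishes[OF assms(1)])
      fix j
      assume j: "j \<noteq> int J + 1" and m: "n \<in> Poly_Mapping.keys (phi_star j \<tau>)"
      show "?m \<notin> Poly_Mapping.keys (phi (- j) \<tau>)"
      proof (cases "j \<le> 0")
        case True
        with heavy show ?thesis
          by (simp add: phi_def keys_deriv_var_iff del: One_nat_def)
      next
        case False
        show ?thesis
        proof
          assume "?m \<in> Poly_Mapping.keys (phi (- j) \<tau>)"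
          with False obtain b where "b \<in> Poly_Mapping.keys \<tau>"
            "?m = b + Poly_Mapping.single (Phi (nat (j - 1))) 1"
            by (auto simp: phi_def elim: keys_mult_var)
          with uniq[of b "nat (j - 1)"] False j m show False
            by (auto simp: phi_star_def keys_deriv_var_iff simp del: One_nat_def)
        qed
      qed
    qed
    with a n show False
      by (simp add: phi_def phi_star_def keys_deriv_var_iff add_single_in_keys_mult_var_iff
          del: One_nat_def)
  qed
qed

theorem proposition3p1:
  fixes \<tau> :: fock
  assumes "Omega (tensor \<tau> \<tau>) = 0"
  shows "\<exists>c::complex. \<tau> = scale c vacuum"
proof
  have "k = 0" if "k \<in> Poly_Mapping.keys \<tau>" for k
  proof -
    have "x \<notin> Poly_Mapping.keys k" for x
      using PhiStar_notin_keys[OF assms that] Phi_notin_keys[OF assms that] by (cases x) auto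
    then show ?thesis by (intro poly_mapping_eqI) (simp add: in_keys_iff)
  qed
  then show "\<tau> = scale (Poly_Mapping.lookup \<tau> 0) vacuum"
    by (intro poly_mapping_eqI) (auto simp: vacuum_def lookup_one when_def in_keys_iff)
qed

end
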